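(* Let $(X,\|\cdot\|_X)$ be a rearrangement invariant Banach function space over a probability space $(\Omega,F,\mathbf{P})$ and let $d\ge 2$. A. Let $g=(g_1,\dots,g_d)$ be a $d$-tuple of measurable functions on $\Omega$. The expression $$l_g(\xi)=\sum_{i=1}^d\int_\Omega \xi(i,\omega)\,g_i(\omega)\,\mathbf{P}(d\omega),\qquad \xi=(\xi(1),\dots,\xi(d))\in X^{(d)},$$ represents an element of the associate space $X^{(d),\prime}$ if and only if $g_i\in X'$ for every $i$, and in this case $$\max_i\|g_i\|_{X'}\le\|l_g\|_{X^{(d),\prime}}\le\sum_{i=1}^d\|g_i\|_{X'}.$$ B. Let $h_1,\dots,h_d$ be linear functionals on $X$. The expression $$h(\xi)=\sum_{i=1}^d h_i(\xi(i)),\qquad \xi\in X^{(d)},$$ represents an element of the conjugate (dual) space $X^{(d),*}$ if and only if $h_i\in X^*$ for every $i$, and in this case $$\max_i\|h_i\|_{X^*}\le\|h\|_{X^{(d),*}}\le\sum_{i=1}^d\|h_i\|_{X^*}.$$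
   Context: The space $X^{(d)}$ consists of all $d$-dimensional random vectors $\xi$ with finite norm $\|\xi\|_{X^{(d)}}=\sup_{b\in S(d)}\|(\xi,b)\|_X$, where $S(d)=\{b\in\mathbb{R}^d:\sum_j b(j)^2\le1\}$ and $(\cdot,\cdot)$ is the Euclidean inner product. $X^*$ and $X'$ denote respectively the conjugate (continuous dual) space and the associate space of $X$, with their usual norms; $X^{(d),*}$ is the continuous dual of $X^{(d)}$ with the dual norm. The associate space $X^{(d),\prime}$ of $X^{(d)}$ is the set of all continuous linear functionals on $X^{(d)}$ having the integral form $l_g$ (with the integrals well defined for all $\xi\in X^{(d)}$), equipped with the norm of functionals on $X^{(d)}$. *)

theory Defs
  imports "HOL-Probability.Probability"
begin

text \<open>
  Function norms in the sense of Bennett and Sharpley: \<open>\<rho>\<close> is defined on nonnegative measurable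
  functions with values in \<open>[0,\<infinity>]\<close>; its values on non-measurable functions are irrelevant.
\<close>

locale banach_function_norm = prob_space M for M :: "'a measure" +
  fixes \<rho> :: "('a \<Rightarrow> ennreal) \<Rightarrow> ennreal"
  assumes norm_eq_0_iff:
      "f \<in> borel_measurable M \<Longrightarrow> \<rho> f = 0 \<longleftrightarrow> (AE x in M. f x = 0)"
    and norm_scale:
      "f \<in> borel_measurable M \<Longrightarrow> 0 \<le> a \<Longrightarrow> \<rho> (\<lambda>x. ennreal a * f x) = ennreal a * \<rho> f"
    and norm_triangle:
      "f \<in> borel_measurable M \<Longrightarrow> g \<in> borel_measurable M \<Longrightarrow> \<rho> (\<lambda>x. f x + g x) \<le> \<rho> f + \<rho> g"
    and norm_mono:
      "f \<in> borel_measurable M \<Longrightarrow> g \<in> borel_measurable M \<Longrightarrow> (AE x in M. g x \<le> f x) \<Longrightarrow> \<rho> g \<le> \<rho> f"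
    and norm_Fatou:
      "(\<And>n. F n \<in> borel_measurable M) \<Longrightarrow> f \<in> borel_measurable M \<Longrightarrow>
        (AE x in M. incseq (\<lambda>n. F n x) \<and> f x = (SUP n::nat. F n x)) \<Longrightarrow> \<rho> f = (SUP n. \<rho> (F n))"
    and norm_indicator_finite:
      "E \<in> sets M \<Longrightarrow> \<rho> (indicator E) < \<infinity>"
    and integral_le_norm:
      "E \<in> sets M \<Longrightarrow>
        \<exists>C::real. 0 < C \<and> (\<forall>f\<in>borel_measurable M. (\<integral>\<^sup>+x\<in>E. f x \<partial>M) \<le> ennreal C * \<rho> f)"

definition equimeasurable :: "'a measure \<Rightarrow> ('a \<Rightarrow> ennreal) \<Rightarrow> ('a \<Rightarrow> ennreal) \<Rightarrow> bool" where
  "equimeasurable M f g \<longleftrightarrow>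
    (\<forall>t. emeasure M {x \<in> space M. t < f x} = emeasure M {x \<in> space M. t < g x})"

locale ri_banach_function_norm = banach_function_norm +
  assumes rearrangement_invariant:
    "f \<in> borel_measurable M \<Longrightarrow> g \<in> borel_measurable M \<Longrightarrow> equimeasurable M f g \<Longrightarrow> \<rho> f = \<rho> g"

text \<open>
  Elements of all spaces below are functions rather than classes modulo a.e. equality, and norms
  take values in \<open>[0,\<infinity>]\<close>.
\<close>

definition fs_norm :: "(('a \<Rightarrow> ennreal) \<Rightarrow> ennreal) \<Rightarrow> ('a \<Rightarrow> real) \<Rightarrow> ennreal" where
  "fs_norm \<rho> f = \<rho> (\<lambda>x. ennreal \<bar>f x\<bar>)"

definition fspace :: "'a measure \<Rightarrow> (('a \<Rightarrow> ennreal) \<Rightarrow> ennreal) \<Rightarrow> ('a \<Rightarrow> real) set" where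
  "fspace M \<rho> = {f \<in> borel_measurable M. fs_norm \<rho> f < \<infinity>}"

text \<open>
  With \<open>\<rho>' = assoc_norm M \<rho>\<close>, the associate space \<open>X'\<close> of \<open>X = fspace M \<rho>\<close> is \<open>fspace M \<rho>'\<close>
  with norm \<open>fs_norm \<rho>'\<close>.
\<close>

definition assoc_norm ::
    "'a measure \<Rightarrow> (('a \<Rightarrow> ennreal) \<Rightarrow> ennreal) \<Rightarrow> ('a \<Rightarrow> ennreal) \<Rightarrow> ennreal" where
  "assoc_norm M \<rho> g = (SUP f\<in>{f \<in> borel_measurable M. \<rho> f \<le> 1}. \<integral>\<^sup>+x. f x * g x \<partial>M)"

definition euclid_unit_ball :: "(real ^ 'n) set" where
  "euclid_unit_ball = {b. (\<Sum>j\<in>UNIV. (b $ j)\<^sup>2) \<le> 1}"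

definition vec_norm :: "(('a \<Rightarrow> ennreal) \<Rightarrow> ennreal) \<Rightarrow> ('a \<Rightarrow> real ^ 'n) \<Rightarrow> ennreal" where
  "vec_norm \<rho> \<xi> = (SUP b\<in>euclid_unit_ball. fs_norm \<rho> (\<lambda>x. \<xi> x \<bullet> b))"

definition vec_space :: "'a measure \<Rightarrow> (('a \<Rightarrow> ennreal) \<Rightarrow> ennreal) \<Rightarrow> ('a \<Rightarrow> real ^ 'n) set" where
  "vec_space M \<rho> = {\<xi> \<in> borel_measurable M. vec_norm \<rho> \<xi> < \<infinity>}"

text \<open>
  The third conjunct says that \<open>h\<close> is well defined modulo a.e. equality. Values of \<open>h\<close> outside
  \<open>V\<close> are irrelevant.
\<close>

definition linear_functional_on ::
    "'a measure \<Rightarrow> ('a \<Rightarrow> 'b::real_vector) set \<Rightarrow> (('a \<Rightarrow> 'b) \<Rightarrow> real) \<Rightarrow> bool" where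
  "linear_functional_on M V h \<longleftrightarrow>
    (\<forall>f\<in>V. \<forall>g\<in>V. h (\<lambda>x. f x + g x) = h f + h g) \<and>
    (\<forall>c. \<forall>f\<in>V. h (\<lambda>x. c *\<^sub>R f x) = c * h f) \<and>
    (\<forall>f\<in>V. \<forall>g\<in>V. (AE x in M. f x = g x) \<longrightarrow> h f = h g)"

definition continuous_functional_on ::
    "('a \<Rightarrow> 'b::real_vector) set \<Rightarrow> (('a \<Rightarrow> 'b) \<Rightarrow> ennreal) \<Rightarrow> (('a \<Rightarrow> 'b) \<Rightarrow> real) \<Rightarrow> bool" where
  "continuous_functional_on V N h \<longleftrightarrow>
    (\<forall>f\<in>V. \<forall>\<epsilon>>0. \<exists>\<delta>>0. \<forall>g\<in>V. N (\<lambda>x. g x - f x) < ennreal \<delta> \<longrightarrow> \<bar>h g - h f\<bar> < \<epsilon>)"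

definition dual_space ::
    "'a measure \<Rightarrow> ('a \<Rightarrow> 'b::real_vector) set \<Rightarrow> (('a \<Rightarrow> 'b) \<Rightarrow> ennreal) \<Rightarrow>
      (('a \<Rightarrow> 'b) \<Rightarrow> real) set" where
  "dual_space M V N = {h. linear_functional_on M V h \<and> continuous_functional_on V N h}"

definition dual_norm ::
    "('a \<Rightarrow> 'b::real_vector) set \<Rightarrow> (('a \<Rightarrow> 'b) \<Rightarrow> ennreal) \<Rightarrow> (('a \<Rightarrow> 'b) \<Rightarrow> real) \<Rightarrow> ennreal" where
  "dual_norm V N h = (SUP f\<in>{f \<in> V. N f \<le> 1}. ennreal \<bar>h f\<bar>)"

definition integral_functional ::
    "'a measure \<Rightarrow> ('n::finite \<Rightarrow> 'a \<Rightarrow> real) \<Rightarrow> ('a \<Rightarrow> real ^ 'n) \<Rightarrow> real" where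
  "integral_functional M g \<xi> = (\<Sum>i\<in>UNIV. \<integral>x. (\<xi> x $ i) * g i x \<partial>M)"

text \<open>Needed separately because the integral of a non-integrable function is \<open>0\<close> by convention.\<close>

definition integrals_well_defined ::
    "'a measure \<Rightarrow> (('a \<Rightarrow> ennreal) \<Rightarrow> ennreal) \<Rightarrow> ('n::finite \<Rightarrow> 'a \<Rightarrow> real) \<Rightarrow> bool" where
  "integrals_well_defined M \<rho> g \<longleftrightarrow>
    (\<forall>\<xi>\<in>vec_space M \<rho>. \<forall>i. integrable M (\<lambda>x. (\<xi> x $ i) * g i x))"

definition vec_assoc_space ::
    "'a measure \<Rightarrow> (('a \<Rightarrow> ennreal) \<Rightarrow> ennreal) \<Rightarrow> (('a \<Rightarrow> real ^ 'n::finite) \<Rightarrow> real) set" where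
  "vec_assoc_space M \<rho> =
    {l \<in> dual_space M (vec_space M \<rho>) (vec_norm \<rho>).
      \<exists>g. (\<forall>i. g i \<in> borel_measurable M) \<and> integrals_well_defined M \<rho> g \<and>
        (\<forall>\<xi>\<in>vec_space M \<rho>. l \<xi> = integral_functional M g \<xi>)}"

definition sum_functional ::
    "('n::finite \<Rightarrow> ('a \<Rightarrow> real) \<Rightarrow> real) \<Rightarrow> ('a \<Rightarrow> real ^ 'n) \<Rightarrow> real" where
  "sum_functional h \<xi> = (\<Sum>i\<in>UNIV. h i (\<lambda>x. \<xi> x $ i))"

end

theory Submission imports Defs begin

text \<open>
  Testing the vector norm against the coordinate vectors shows that the coordinate projections
  \<open>X\<^sup>(\<^sup>d\<^sup>) \<rightarrow> X\<close> do not increase the norm, and neither do the coordinate embeddings \<open>f \<mapsto> axis i f\<close>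
  of \<open>X\<close>. Restricting a functional along the embeddings and composing with the projections gives
  part B. Part A is part B applied to the functionals \<open>f \<mapsto> \<integral> f g\<^sub>i\<close>, once their norms on \<open>X\<close> are
  identified with the associate norms of the \<open>g\<^sub>i\<close>.
\<close>

section \<open>Linear and continuous functionals on a general space\<close>

lemma linear_functional_add:
  assumes "linear_functional_on M V h" "f \<in> V" "g \<in> V"
  shows "h (\<lambda>x. f x + g x) = h f + h g"
  using assms unfolding linear_functional_on_def by blast

lemma linear_functional_scaleR:
  assumes "linear_functional_on M V h" "f \<in> V"
  shows "h (\<lambda>x. c *\<^sub>R f x) = c * h f"
  using assms unfolding linear_functional_on_def by blast

lemma linear_functional_cong_AE:
  assumes "linear_functional_on M V h" "f \<in> V" "g \<in> V" "AE x in M. f x = g x"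
  shows "h f = h g"
  using assms unfolding linear_functional_on_def by blast

lemma continuous_functional_onE:
  assumes "continuous_functional_on V N h" "f \<in> V" "\<epsilon> > 0"
  obtains \<delta> where "\<delta> > 0"
    "\<And>g. g \<in> V \<Longrightarrow> N (\<lambda>x. g x - f x) < ennreal \<delta> \<Longrightarrow> \<bar>h g - h f\<bar> < \<epsilon>"
proof -
  from assms have "\<exists>\<delta>>0. \<forall>g\<in>V. N (\<lambda>x. g x - f x) < ennreal \<delta> \<longrightarrow> \<bar>h g - h f\<bar> < \<epsilon>"
    by (simp add: continuous_functional_on_def)
  then show thesis
    using that by auto
qed

context banach_function_norm
begin

section \<open>The scalar space \<open>X\<close>: its norm and vector space structure\<close>

lemma fs_norm_mono:
  assumes "f \<in> borel_measurable M" "g \<in> borel_measurable M" "\<And>x. \<bar>f x\<bar> \<le> \<bar>g x\<bar>"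
  shows "fs_norm \<rho> f \<le> fs_norm \<rho> g"
  unfolding fs_norm_def using assms by (intro norm_mono) (auto simp: ennreal_leI)

lemma fs_norm_cmult:
  assumes "f \<in> borel_measurable M"
  shows "fs_norm \<rho> (\<lambda>x. c * f x) = ennreal \<bar>c\<bar> * fs_norm \<rho> f"
  unfolding fs_norm_def using norm_scale[of "\<lambda>x. ennreal \<bar>f x\<bar>" "\<bar>c\<bar>"] assms
  by (simp add: abs_mult ennreal_mult)

lemma fs_norm_add:
  assumes "f \<in> borel_measurable M" "g \<in> borel_measurable M"
  shows "fs_norm \<rho> (\<lambda>x. f x + g x) \<le> fs_norm \<rho> f + fs_norm \<rho> g"
proof -
  have "fs_norm \<rho> (\<lambda>x. f x + g x) \<le> \<rho> (\<lambda>x. ennreal \<bar>f x\<bar> + ennreal \<bar>g x\<bar>)"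
    unfolding fs_norm_def using assms
    by (intro norm_mono) (auto simp flip: ennreal_plus intro!: ennreal_leI)
  also have "\<dots> \<le> fs_norm \<rho> f + fs_norm \<rho> g"
    unfolding fs_norm_def using assms by (intro norm_triangle) auto
  finally show ?thesis .
qed

lemma fs_norm_eq_0_iff:
  "f \<in> borel_measurable M \<Longrightarrow> fs_norm \<rho> f = 0 \<longleftrightarrow> (AE x in M. f x = 0)"
  unfolding fs_norm_def by (subst norm_eq_0_iff) auto

lemma fs_norm_zero [simp]: "fs_norm \<rho> (\<lambda>x. 0) = 0"
  by (simp add: fs_norm_eq_0_iff)

lemma fspace_measurable: "f \<in> fspace M \<rho> \<Longrightarrow> f \<in> borel_measurable M"
  by (simp add: fspace_def)

lemma fspace_zero [simp]: "(\<lambda>x. 0) \<in> fspace M \<rho>"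
  by (simp add: fspace_def)

lemma fspace_cmult: "f \<in> fspace M \<rho> \<Longrightarrow> (\<lambda>x. c * f x) \<in> fspace M \<rho>"
  by (auto simp: fspace_def fs_norm_cmult ennreal_mult_less_top)

lemma fspace_add:
  assumes "f \<in> fspace M \<rho>" "g \<in> fspace M \<rho>"
  shows "(\<lambda>x. f x + g x) \<in> fspace M \<rho>"
  using assms fs_norm_add[of f g] by (auto simp: fspace_def intro: le_less_trans)

lemma fspace_diff:
  assumes "f \<in> fspace M \<rho>" "g \<in> fspace M \<rho>"
  shows "(\<lambda>x. f x - g x) \<in> fspace M \<rho>"
  using fspace_add[OF assms(1) fspace_cmult[OF assms(2), of "-1"]] by simp

text \<open>\<open>integral_le_norm\<close> with \<open>E\<close> the whole space bounds the
  integral of \<open>f\<close> by a multiple of its norm. This allows extended-valued test functions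
  of the associate norm to be replaced by real-valued elements of \<open>X\<close>.\<close>

lemma norm_finite_imp_AE_finite:
  assumes f: "f \<in> borel_measurable M" and "\<rho> f < \<infinity>"
  shows "AE x in M. f x \<noteq> \<infinity>"
proof -
  obtain C :: real where "\<forall>f\<in>borel_measurable M. (\<integral>\<^sup>+x\<in>space M. f x \<partial>M) \<le> ennreal C * \<rho> f"
    using integral_le_norm[of "space M"] by auto
  then have "(\<integral>\<^sup>+x\<in>space M. f x \<partial>M) \<le> ennreal C * \<rho> f"
    using f by blast
  also have "\<dots> < \<infinity>"
    using assms by (simp add: ennreal_mult_less_top)
  finally have "(\<integral>\<^sup>+x. f x \<partial>M) < \<infinity>"
    by (simp add: nn_set_integral_space)
  then show ?thesis
    using f by (intro nn_integral_PInf_AE) auto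
qed

section \<open>Bounded linear functionals on \<open>X\<close>\<close>

lemma linear_functional_0:
  assumes "linear_functional_on M (fspace M \<rho>) h"
  shows "h (\<lambda>x. 0) = 0"
  using linear_functional_scaleR[OF assms fspace_zero, of 0] by simp

lemma linear_functional_diff:
  assumes h: "linear_functional_on M (fspace M \<rho>) h" and fg: "f \<in> fspace M \<rho>" "g \<in> fspace M \<rho>"
  shows "h (\<lambda>x. f x - g x) = h f - h g"
  using linear_functional_add[OF h fspace_diff[OF fg] fg(2)] by simp

text \<open>Homogeneity carries the supremum over the unit ball to all of \<open>X\<close>. A
  function of norm 0 cannot be normalised, but it vanishes almost everywhere, so \<open>h\<close>
  sends it to 0. The dual norm may be infinite here.\<close>

lemma dual_norm_bound:
  assumes h: "linear_functional_on M (fspace M \<rho>) h" and f: "f \<in> fspace M \<rho>"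
  shows "ennreal \<bar>h f\<bar> \<le> fs_norm \<rho> f * dual_norm (fspace M \<rho>) (fs_norm \<rho>) h"
proof (cases "fs_norm \<rho> f = 0")
  case True
  then have "AE x in M. f x = 0"
    using fs_norm_eq_0_iff[OF fspace_measurable[OF f]] by simp
  then have "h f = h (\<lambda>x. 0)"
    by (rule linear_functional_cong_AE[OF h f fspace_zero])
  then show ?thesis
    using linear_functional_0[OF h] by simp
next
  case False
  define r where "r = enn2real (fs_norm \<rho> f)"
  have r: "fs_norm \<rho> f = ennreal r" and r_pos: "r > 0"
    using False f by (auto simp: r_def fspace_def enn2real_positive_iff zero_less_iff_neq_zero)
  \<comment> \<open>The normalisation of \<open>f\<close>, a competitor in the supremum defining the
    dual norm.\<close>
  define g where "g = (\<lambda>x. inverse r * f x)"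
  have "fs_norm \<rho> g = 1"
    using r_pos f by (simp add: g_def fs_norm_cmult fspace_measurable r flip: ennreal_mult)
  then have "g \<in> {f \<in> fspace M \<rho>. fs_norm \<rho> f \<le> 1}"
    using fspace_cmult[OF f, of "inverse r"] by (simp add: g_def)
  then have g: "ennreal \<bar>h g\<bar> \<le> dual_norm (fspace M \<rho>) (fs_norm \<rho>) h"
    unfolding dual_norm_def by (rule SUP_upper)
  have "h (\<lambda>x. inverse r *\<^sub>R f x) = inverse r * h f"
    by (rule linear_functional_scaleR[OF h f])
  then have "\<bar>h f\<bar> = r * \<bar>h g\<bar>"
    using r_pos by (simp add: g_def abs_mult)
  then show ?thesis
    using g r_pos by (simp add: r ennreal_mult mult_left_mono)
qed

text \<open>The usual equivalence of continuity and boundedness. It connects the dual space, defined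
  by continuity, with the associate space, defined by finiteness of a norm.\<close>

lemma continuous_functional_iff_dual_norm_finite:
  assumes h: "linear_functional_on M (fspace M \<rho>) h"
  shows "continuous_functional_on (fspace M \<rho>) (fs_norm \<rho>) h \<longleftrightarrow>
    dual_norm (fspace M \<rho>) (fs_norm \<rho>) h < \<infinity>"
proof
  assume "continuous_functional_on (fspace M \<rho>) (fs_norm \<rho>) h"
  from continuous_functional_onE[OF this fspace_zero zero_less_one]
  obtain \<delta> where "\<delta> > 0"
    "\<And>g. g \<in> fspace M \<rho> \<Longrightarrow> fs_norm \<rho> (\<lambda>x. g x - 0) < ennreal \<delta> \<Longrightarrow> \<bar>h g - h (\<lambda>x. 0)\<bar> < 1"
    by blast
  then have \<delta>: "\<delta> > 0" "\<And>g. g \<in> fspace M \<rho> \<Longrightarrow> fs_norm \<rho> g < ennreal \<delta> \<Longrightarrow> \<bar>h g\<bar> < 1"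
    by (simp_all add: linear_functional_0[OF h])
  \<comment> \<open>Scaling by \<delta>/2 rather than \<delta> puts the closed unit ball strictly
    inside the ball of radius \<delta>, where \<open>h\<close> is less than 1 in absolute
    value.\<close>
  have "ennreal \<bar>h f\<bar> \<le> ennreal (2 / \<delta>)" if f: "f \<in> fspace M \<rho>" "fs_norm \<rho> f \<le> 1" for f
  proof -
    have "fs_norm \<rho> (\<lambda>x. \<delta> / 2 * f x) = ennreal (\<delta> / 2) * fs_norm \<rho> f"
      using fs_norm_cmult[of f "\<delta> / 2"] f \<delta> by (simp add: fspace_measurable)
    also have "\<dots> \<le> ennreal (\<delta> / 2) * 1"
      using f by (intro mult_left_mono) auto
    also have "\<dots> < ennreal \<delta>"
      using \<delta> by (simp add: ennreal_lessI)
    finally have "\<bar>h (\<lambda>x. \<delta> / 2 * f x)\<bar> < 1"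
      using f by (intro \<delta> fspace_cmult)
    moreover have "h (\<lambda>x. (\<delta> / 2) *\<^sub>R f x) = \<delta> / 2 * h f"
      by (rule linear_functional_scaleR[OF h f(1)])
    ultimately have "\<bar>h f\<bar> \<le> 2 / \<delta>"
      using \<delta>(1) by (simp add: abs_mult field_simps)
    then show ?thesis
      by (rule ennreal_leI)
  qed
  then have "dual_norm (fspace M \<rho>) (fs_norm \<rho>) h \<le> ennreal (2 / \<delta>)"
    unfolding dual_norm_def by (auto intro: SUP_least)
  then show "dual_norm (fspace M \<rho>) (fs_norm \<rho>) h < \<infinity>"
    by (rule le_less_trans) simp
next
  assume "dual_norm (fspace M \<rho>) (fs_norm \<rho>) h < \<infinity>"
  then obtain K where K: "K \<ge> 0" "dual_norm (fspace M \<rho>) (fs_norm \<rho>) h = ennreal K"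
    by (cases "dual_norm (fspace M \<rho>) (fs_norm \<rho>) h") auto
  show "continuous_functional_on (fspace M \<rho>) (fs_norm \<rho>) h"
    unfolding continuous_functional_on_def
  proof (intro ballI allI impI)
    fix f and \<epsilon> :: real
    assume f: "f \<in> fspace M \<rho>" and \<epsilon>: "\<epsilon> > 0"
    \<comment> \<open>Dividing by \<open>K + 1\<close> instead of \<open>K\<close> covers
      \<open>K = 0\<close> and keeps the final estimate strict, since
      \<open>K / (K + 1) < 1\<close>.\<close>
    have "\<bar>h g - h f\<bar> < \<epsilon>"
      if g: "g \<in> fspace M \<rho>" "fs_norm \<rho> (\<lambda>x. g x - f x) < ennreal (\<epsilon> / (K + 1))" for g
    proof -
      have "ennreal \<bar>h g - h f\<bar> \<le> fs_norm \<rho> (\<lambda>x. g x - f x) * ennreal K"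
        using dual_norm_bound[OF h fspace_diff[OF g(1) f]] linear_functional_diff[OF h g(1) f] K
        by simp
      also have "\<dots> \<le> ennreal (\<epsilon> / (K + 1)) * ennreal K"
        using g by (intro mult_right_mono) auto
      also have "\<dots> < ennreal \<epsilon>"
        using K \<epsilon> by (auto simp flip: ennreal_mult intro!: ennreal_lessI simp: field_simps)
      finally show ?thesis
        using \<epsilon> by (simp add: ennreal_less_iff)
    qed
    then show "\<exists>\<delta>>0. \<forall>g\<in>fspace M \<rho>. fs_norm \<rho> (\<lambda>x. g x - f x) < ennreal \<delta> \<longrightarrow> \<bar>h g - h f\<bar> < \<epsilon>"
      using K \<epsilon> by (intro exI[of _ "\<epsilon> / (K + 1)"]) auto
  qed
qed

section \<open>The associate space as a space of functionals on \<open>X\<close>\<close>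

lemma assoc_norm_finite_imp_integrable:
  assumes f: "f \<in> fspace M \<rho>" and g: "g \<in> fspace M (assoc_norm M \<rho>)"
  shows "integrable M (\<lambda>x. f x * g x)"
proof -
  have meas [measurable]: "f \<in> borel_measurable M" "g \<in> borel_measurable M"
    using f g by (auto simp: fspace_def)
  define N where "N = fs_norm \<rho> f"
  have "(\<integral>\<^sup>+x. ennreal \<bar>f x\<bar> * ennreal \<bar>g x\<bar> \<partial>M) < \<infinity>"
  proof (cases "N = 0")
    case True
    then have "AE x in M. f x = 0"
      using fs_norm_eq_0_iff by (simp add: N_def)
    then have "(\<integral>\<^sup>+x. ennreal \<bar>f x\<bar> * ennreal \<bar>g x\<bar> \<partial>M) = (\<integral>\<^sup>+x. 0 \<partial>M)"
      by (intro nn_integral_cong_AE) (auto elim: eventually_mono)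
    then show ?thesis by simp
  next
    case False
    define r where "r = enn2real N"
    have N: "N = ennreal r" and r_pos: "r > 0"
      using False f by (auto simp: r_def N_def fspace_def enn2real_positive_iff zero_less_iff_neq_zero)
    \<comment> \<open>Hoelder's inequality by normalisation: \<open>?u\<close> has norm 1, so it is
      admissible in the supremum defining \<open>assoc_norm\<close>.\<close>
    let ?u = "\<lambda>x. ennreal (inverse r) * ennreal \<bar>f x\<bar>"
    have "\<rho> ?u = ennreal (inverse r) * N"
      unfolding N_def fs_norm_def using r_pos by (intro norm_scale) auto
    also have "\<dots> = 1"
      using r_pos by (simp add: N flip: ennreal_mult)
    finally have "(\<integral>\<^sup>+x. ?u x * ennreal \<bar>g x\<bar> \<partial>M) \<le> fs_norm (assoc_norm M \<rho>) g"
      unfolding fs_norm_def assoc_norm_def by (intro SUP_upper) auto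
    also have "\<dots> < \<infinity>"
      using g by (simp add: fspace_def)
    \<comment> \<open>The scaling factor is strictly positive, so finiteness of the scaled integral
      passes to the original one.\<close>
    also have "(\<integral>\<^sup>+x. ?u x * ennreal \<bar>g x\<bar> \<partial>M) =
        ennreal (inverse r) * (\<integral>\<^sup>+x. ennreal \<bar>f x\<bar> * ennreal \<bar>g x\<bar> \<partial>M)"
      by (subst nn_integral_cmult[symmetric]) (auto simp: mult.assoc)
    finally show ?thesis
      using r_pos by (auto simp: ennreal_mult_less_top)
  qed
  then show ?thesis
    by (intro integrableI_bounded) (auto simp: abs_mult ennreal_mult)
qed

text \<open>The two suprema differ in their competitors: nonnegative extended-valued functions
  tested against \<open>\<bar>g\<bar>\<close> on the left, real functions of any sign tested against
  \<open>g\<close> on the right. Transferring the sign of \<open>g\<close> to the test function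
  gives one inequality, taking absolute values the other.\<close>

lemma assoc_norm_eq_dual_norm:
  assumes g [measurable]: "g \<in> borel_measurable M"
    and int: "\<And>f. f \<in> fspace M \<rho> \<Longrightarrow> integrable M (\<lambda>x. f x * g x)"
  shows "fs_norm (assoc_norm M \<rho>) g =
    dual_norm (fspace M \<rho>) (fs_norm \<rho>) (\<lambda>f. \<integral>x. f x * g x \<partial>M)"
proof (rule antisym)
  show "fs_norm (assoc_norm M \<rho>) g \<le>
    dual_norm (fspace M \<rho>) (fs_norm \<rho>) (\<lambda>f. \<integral>x. f x * g x \<partial>M)"
    unfolding fs_norm_def[of "assoc_norm M \<rho>"] assoc_norm_def
  proof (rule SUP_least)
    fix f assume "f \<in> {f \<in> borel_measurable M. \<rho> f \<le> 1}"
    then have f [measurable]: "f \<in> borel_measurable M" and f_le: "\<rho> f \<le> 1"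
      by auto
    have fin: "AE x in M. f x \<noteq> \<infinity>"
      using f f_le by (intro norm_finite_imp_AE_finite) (auto intro: le_less_trans)
    \<comment> \<open>a sign of \<open>g\<close> that never vanishes, so that \<open>\<bar>u\<bar> = f\<close> almost everywhere\<close>
    define u where "u = (\<lambda>x. enn2real (f x) * (if g x < 0 then - 1 else 1))"
    have u [measurable]: "u \<in> borel_measurable M"
      unfolding u_def by measurable
    have abs_u: "\<bar>u x\<bar> = enn2real (f x)" for x
      by (simp add: u_def)
    \<comment> \<open>The two functions agree only almost everywhere, so equality of norms comes
      from monotonicity in both directions.\<close>
    have "fs_norm \<rho> u = \<rho> f"
      unfolding fs_norm_def using fin
      by (intro antisym norm_mono) (auto simp: abs_u less_top elim: eventually_mono)
    with f_le have u_mem: "u \<in> {f \<in> fspace M \<rho>. fs_norm \<rho> f \<le> 1}"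
      using u by (auto simp: fspace_def intro: le_less_trans)
    have ug: "u x * g x = enn2real (f x) * \<bar>g x\<bar>" for x
      by (simp add: u_def)
    \<comment> \<open>\<open>enn2real\<close> sends infinity to 0, so the integrands may differ
      where \<open>f\<close> is infinite; by \<open>fin\<close> this happens only on a null
      set.\<close>
    have "(\<integral>\<^sup>+x. f x * ennreal \<bar>g x\<bar> \<partial>M) = (\<integral>\<^sup>+x. ennreal (u x * g x) \<partial>M)"
      using fin
      by (intro nn_integral_cong_AE) (auto simp: ug ennreal_mult less_top elim!: eventually_mono)
    also have "\<dots> = ennreal (\<integral>x. u x * g x \<partial>M)"
      using u_mem by (intro nn_integral_eq_integral int) (auto simp: ug)
    also have "\<dots> \<le> ennreal \<bar>\<integral>x. u x * g x \<partial>M\<bar>"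
      by (intro ennreal_leI) simp
    also have "\<dots> \<le> dual_norm (fspace M \<rho>) (fs_norm \<rho>) (\<lambda>f. \<integral>x. f x * g x \<partial>M)"
      unfolding dual_norm_def using u_mem by (rule SUP_upper)
    finally show "(\<integral>\<^sup>+x. f x * ennreal \<bar>g x\<bar> \<partial>M) \<le>
      dual_norm (fspace M \<rho>) (fs_norm \<rho>) (\<lambda>f. \<integral>x. f x * g x \<partial>M)" .
  qed
next
  show "dual_norm (fspace M \<rho>) (fs_norm \<rho>) (\<lambda>f. \<integral>x. f x * g x \<partial>M) \<le>
    fs_norm (assoc_norm M \<rho>) g"
    unfolding dual_norm_def
  proof (rule SUP_least)
    fix f assume f: "f \<in> {f \<in> fspace M \<rho>. fs_norm \<rho> f \<le> 1}"
    then have [measurable]: "f \<in> borel_measurable M"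
      by (simp add: fspace_def)
    have "ennreal \<bar>\<integral>x. f x * g x \<partial>M\<bar> \<le> (\<integral>\<^sup>+x. ennreal \<bar>f x * g x\<bar> \<partial>M)"
      using integral_norm_bound_ennreal[OF int, of f] f by simp
    also have "\<dots> = (\<integral>\<^sup>+x. ennreal \<bar>f x\<bar> * ennreal \<bar>g x\<bar> \<partial>M)"
      by (simp add: abs_mult ennreal_mult)
    also have "\<dots> \<le> fs_norm (assoc_norm M \<rho>) g"
      unfolding fs_norm_def[of "assoc_norm M \<rho>"] assoc_norm_def
      using f by (intro SUP_upper) (auto simp: fs_norm_def)
    finally show "ennreal \<bar>\<integral>x. f x * g x \<partial>M\<bar> \<le> fs_norm (assoc_norm M \<rho>) g" .
  qed
qed

lemma linear_functional_integral:
  assumes g [measurable]: "g \<in> borel_measurable M"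
    and int: "\<And>f. f \<in> fspace M \<rho> \<Longrightarrow> integrable M (\<lambda>x. f x * g x)"
  shows "linear_functional_on M (fspace M \<rho>) (\<lambda>f. \<integral>x. f x * g x \<partial>M)"
  unfolding linear_functional_on_def
proof (intro conjI ballI allI impI)
  fix u v assume uv: "u \<in> fspace M \<rho>" "v \<in> fspace M \<rho>"
  show "(\<integral>x. (u x + v x) * g x \<partial>M) = (\<integral>x. u x * g x \<partial>M) + (\<integral>x. v x * g x \<partial>M)"
    using int uv by (simp add: distrib_right)
  assume "AE x in M. u x = v x"
  then show "(\<integral>x. u x * g x \<partial>M) = (\<integral>x. v x * g x \<partial>M)"
    using fspace_measurable[OF uv(1)] fspace_measurable[OF uv(2)]
    by (intro integral_cong_AE) (auto elim: eventually_mono)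
next
  fix c u assume "u \<in> fspace M \<rho>"
  then show "(\<integral>x. (c *\<^sub>R u x) * g x \<partial>M) = c * (\<integral>x. u x * g x \<partial>M)"
    by (simp add: mult.assoc)
qed

text \<open>Hoelder's inequality supplies integrability; given integrability, the associate norm is
  the dual norm, whose finiteness means continuity. Integrability is a conjunct of its own because
  the integral of a non-integrable product is 0 by convention.\<close>

lemma fspace_assoc_iff:
  assumes g: "g \<in> borel_measurable M"
  shows "g \<in> fspace M (assoc_norm M \<rho>) \<longleftrightarrow>
    (\<forall>f\<in>fspace M \<rho>. integrable M (\<lambda>x. f x * g x)) \<and>
    (\<lambda>f. \<integral>x. f x * g x \<partial>M) \<in> dual_space M (fspace M \<rho>) (fs_norm \<rho>)"
    (is "?L \<longleftrightarrow> ?I \<and> ?D")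
proof -
  have "?I" if ?L
    using that assoc_norm_finite_imp_integrable by blast
  moreover have "?L \<longleftrightarrow> ?D" if ?I
  proof -
    have int: "\<And>f. f \<in> fspace M \<rho> \<Longrightarrow> integrable M (\<lambda>x. f x * g x)"
      using that by blast
    note lin = linear_functional_integral[OF g int]
    show ?thesis
      using g assoc_norm_eq_dual_norm[OF g int] lin continuous_functional_iff_dual_norm_finite[OF lin]
      by (simp add: fspace_def dual_space_def)
  qed
  ultimately show ?thesis by blast
qed

section \<open>Coordinate projections and embeddings between \<open>X\<close> and the vector
  space\<close>

lemma vec_norm_component_le:
  "fs_norm \<rho> (\<lambda>x. \<xi> x $ i) \<le> vec_norm \<rho> (\<xi> :: 'a \<Rightarrow> real ^ 'n::finite)"
proof -
  \<comment> \<open>A coordinate vector is an admissible direction \<open>b\<close>, and its inner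
    product with \<xi> is the \<open>i\<close>-th component.\<close>
  have "(axis i 1 :: real ^ 'n) \<in> euclid_unit_ball"
    by (simp add: euclid_unit_ball_def axis_def if_distrib[of "\<lambda>z. z\<^sup>2"] cong: if_cong)
  then have "fs_norm \<rho> (\<lambda>x. \<xi> x \<bullet> axis i 1) \<le> vec_norm \<rho> \<xi>"
    unfolding vec_norm_def by (rule SUP_upper)
  then show ?thesis
    by (simp add: inner_axis)
qed

lemma euclid_unit_ball_component:
  assumes "(b :: real ^ 'n::finite) \<in> euclid_unit_ball"
  shows "\<bar>b $ i\<bar> \<le> 1"
proof -
  have "(b $ i)\<^sup>2 \<le> (\<Sum>j\<in>UNIV. (b $ j)\<^sup>2)"
    by (rule member_le_sum) auto
  then have "(b $ i)\<^sup>2 \<le> 1"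
    using assms by (simp add: euclid_unit_ball_def)
  then show ?thesis
    by (simp add: abs_square_le_1)
qed

lemma measurable_component:
  assumes "(\<xi> :: 'a \<Rightarrow> real ^ 'n::finite) \<in> borel_measurable M"
  shows "(\<lambda>x. \<xi> x $ i) \<in> borel_measurable M"
  using borel_measurable_inner[OF assms borel_measurable_const, of "axis i 1"]
  by (simp add: inner_axis)

lemma vec_space_component:
  assumes "(\<xi> :: 'a \<Rightarrow> real ^ 'n::finite) \<in> vec_space M \<rho>"
  shows "(\<lambda>x. \<xi> x $ i) \<in> fspace M \<rho>"
  using assms measurable_component vec_norm_component_le[of \<xi> i]
  by (auto simp: vec_space_def fspace_def intro: le_less_trans)

lemma measurable_axis:
  assumes "f \<in> borel_measurable M"
  shows "(\<lambda>x. axis i (f x) :: real ^ 'n::finite) \<in> borel_measurable M"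
proof -
  \<comment> \<open>Writing the embedding as a scalar function times a constant vector reduces its
    measurability to that of \<open>f\<close>.\<close>
  have "(\<lambda>x. axis i (f x) :: real ^ 'n) = (\<lambda>x. f x *\<^sub>R axis i 1)"
    by (auto simp: vec_eq_iff axis_def)
  then show ?thesis
    using assms by simp
qed

text \<open>The inner product with \<open>b\<close> is \<open>f\<close> multiplied by
  \<open>b $ i\<close>, and this factor is at most 1 in absolute value on the unit ball.\<close>

lemma vec_norm_axis_le:
  assumes f: "f \<in> borel_measurable M"
  shows "vec_norm \<rho> (\<lambda>x. axis i (f x) :: real ^ 'n::finite) \<le> fs_norm \<rho> f"
  unfolding vec_norm_def
proof (rule SUP_least)
  fix b :: "real ^ 'n" assume "b \<in> euclid_unit_ball"
  then have "\<bar>b $ i\<bar> \<le> 1"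
    by (rule euclid_unit_ball_component)
  then show "fs_norm \<rho> (\<lambda>x. axis i (f x) \<bullet> b) \<le> fs_norm \<rho> f"
    using f by (intro fs_norm_mono) (auto simp: inner_axis' abs_mult mult_left_le)
qed

lemma vec_space_axis:
  assumes "f \<in> fspace M \<rho>"
  shows "(\<lambda>x. axis i (f x) :: real ^ 'n::finite) \<in> vec_space M \<rho>"
  using assms measurable_axis vec_norm_axis_le[of f]
  by (auto simp: vec_space_def fspace_def intro: le_less_trans)

section \<open>Part B: functionals acting coordinatewise\<close>

lemma sum_functional_axis:
  fixes h :: "'n::finite \<Rightarrow> ('a \<Rightarrow> real) \<Rightarrow> real"
  assumes "\<And>i. linear_functional_on M (fspace M \<rho>) (h i)"
  shows "sum_functional h (\<lambda>x. axis i (f x)) = h i f"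
proof -
  \<comment> \<open>Each coordinate other than \<open>i\<close> contributes the value of
    \<open>h j\<close> at the zero function, which is 0 by linearity.\<close>
  have "h j (\<lambda>x. axis i (f x) $ j) = (if j = i then h i f else 0)" for j
    using linear_functional_0[OF assms] by (auto simp: axis_def)
  then show ?thesis
    by (simp add: sum_functional_def)
qed

lemma linear_sum_functional:
  fixes h :: "'n::finite \<Rightarrow> ('a \<Rightarrow> real) \<Rightarrow> real"
  assumes h: "\<And>i. linear_functional_on M (fspace M \<rho>) (h i)"
  shows "linear_functional_on M (vec_space M \<rho>) (sum_functional h)"
  unfolding linear_functional_on_def
proof (intro conjI ballI allI impI)
  fix \<xi> \<eta> :: "'a \<Rightarrow> real ^ 'n" assume "\<xi> \<in> vec_space M \<rho>" "\<eta> \<in> vec_space M \<rho>"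
  then have comp: "(\<lambda>x. \<xi> x $ i) \<in> fspace M \<rho>" "(\<lambda>x. \<eta> x $ i) \<in> fspace M \<rho>" for i
    by (auto intro: vec_space_component)
  have "h i (\<lambda>x. \<xi> x $ i + \<eta> x $ i) = h i (\<lambda>x. \<xi> x $ i) + h i (\<lambda>x. \<eta> x $ i)" for i
    by (rule linear_functional_add[OF h comp])
  then show "sum_functional h (\<lambda>x. \<xi> x + \<eta> x) = sum_functional h \<xi> + sum_functional h \<eta>"
    by (simp add: sum_functional_def sum.distrib)
  assume "AE x in M. \<xi> x = \<eta> x"
  then have "AE x in M. \<xi> x $ i = \<eta> x $ i" for i
    by (rule eventually_mono) simp
  then have "h i (\<lambda>x. \<xi> x $ i) = h i (\<lambda>x. \<eta> x $ i)" for i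
    by (rule linear_functional_cong_AE[OF h comp])
  then show "sum_functional h \<xi> = sum_functional h \<eta>"
    by (simp add: sum_functional_def)
next
  fix c and \<xi> :: "'a \<Rightarrow> real ^ 'n" assume "\<xi> \<in> vec_space M \<rho>"
  then have comp: "(\<lambda>x. \<xi> x $ i) \<in> fspace M \<rho>" for i
    by (rule vec_space_component)
  have "h i (\<lambda>x. c *\<^sub>R (\<xi> x $ i)) = c * h i (\<lambda>x. \<xi> x $ i)" for i
    by (rule linear_functional_scaleR[OF h comp])
  then show "sum_functional h (\<lambda>x. c *\<^sub>R \<xi> x) = c * sum_functional h \<xi>"
    by (simp add: sum_functional_def sum_distrib_left)
qed

text \<open>\<open>h i\<close> is the sum functional composed with the \<open>i\<close>-th
  embedding, which is linear and does not increase norms. The same \<delta> therefore works for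
  \<open>h i\<close>.\<close>

lemma continuous_sum_functional_imp_component:
  fixes h :: "'n::finite \<Rightarrow> ('a \<Rightarrow> real) \<Rightarrow> real"
  assumes h: "\<And>i. linear_functional_on M (fspace M \<rho>) (h i)"
    and cont: "continuous_functional_on (vec_space M \<rho>) (vec_norm \<rho>) (sum_functional h)"
  shows "continuous_functional_on (fspace M \<rho>) (fs_norm \<rho>) (h i)"
  unfolding continuous_functional_on_def
proof (intro ballI allI impI)
  fix f and \<epsilon> :: real
  assume f: "f \<in> fspace M \<rho>" and \<epsilon>: "\<epsilon> > 0"
  obtain \<delta> where \<delta>: "\<delta> > 0" "\<And>\<eta>. \<eta> \<in> vec_space M \<rho> \<Longrightarrow>
      vec_norm \<rho> (\<lambda>x. \<eta> x - axis i (f x)) < ennreal \<delta> \<Longrightarrow>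
      \<bar>sum_functional h \<eta> - sum_functional h (\<lambda>x. axis i (f x))\<bar> < \<epsilon>"
    using continuous_functional_onE[OF cont vec_space_axis[OF f] \<epsilon>] by blast
  have "\<bar>h i g - h i f\<bar> < \<epsilon>"
    if g: "g \<in> fspace M \<rho>" "fs_norm \<rho> (\<lambda>x. g x - f x) < ennreal \<delta>" for g
  proof -
    have "(\<lambda>x. axis i (g x) - axis i (f x) :: real ^ 'n) = (\<lambda>x. axis i (g x - f x))"
      by (auto simp: vec_eq_iff axis_def)
    then have "vec_norm \<rho> (\<lambda>x. axis i (g x) - axis i (f x) :: real ^ 'n) < ennreal \<delta>"
      using vec_norm_axis_le[OF fspace_measurable[OF fspace_diff[OF g(1) f]], of i] g(2)
      by (auto intro: le_less_trans)
    from \<delta>(2)[OF vec_space_axis[OF g(1)] this] show ?thesis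
      by (simp add: sum_functional_axis[OF h])
  qed
  then show "\<exists>\<delta>>0. \<forall>g\<in>fspace M \<rho>. fs_norm \<rho> (\<lambda>x. g x - f x) < ennreal \<delta> \<longrightarrow>
      \<bar>h i g - h i f\<bar> < \<epsilon>"
    using \<delta>(1) by blast
qed

text \<open>The projections do not increase norms, so closeness in the vector norm gives closeness
  in every coordinate, and the finitely many errors add up.\<close>

lemma continuous_sum_functional:
  fixes h :: "'n::finite \<Rightarrow> ('a \<Rightarrow> real) \<Rightarrow> real"
  assumes cont: "\<And>i. continuous_functional_on (fspace M \<rho>) (fs_norm \<rho>) (h i)"
  shows "continuous_functional_on (vec_space M \<rho>) (vec_norm \<rho>) (sum_functional h)"
  unfolding continuous_functional_on_def
proof (intro ballI allI impI)
  fix \<xi> :: "'a \<Rightarrow> real ^ 'n" and \<epsilon> :: real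
  assume \<xi>: "\<xi> \<in> vec_space M \<rho>" and \<epsilon>: "\<epsilon> > 0"
  \<comment> \<open>The error \<epsilon> is split equally among the coordinates.\<close>
  define e where "e = \<epsilon> / real CARD('n)"
  have e: "e > 0"
    using \<epsilon> by (simp add: e_def)
  have "\<forall>i. \<exists>\<delta>>0. \<forall>g\<in>fspace M \<rho>. fs_norm \<rho> (\<lambda>x. g x - \<xi> x $ i) < ennreal \<delta> \<longrightarrow>
      \<bar>h i g - h i (\<lambda>x. \<xi> x $ i)\<bar> < e"
    using cont e vec_space_component[OF \<xi>] by (simp add: continuous_functional_on_def)
  from choice[OF this] obtain D where D: "\<And>i. D i > 0"
    "\<And>i g. g \<in> fspace M \<rho> \<Longrightarrow> fs_norm \<rho> (\<lambda>x. g x - \<xi> x $ i) < ennreal (D i) \<Longrightarrow>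
      \<bar>h i g - h i (\<lambda>x. \<xi> x $ i)\<bar> < e"
    by blast
  \<comment> \<open>The index type is finite, so this minimum of positive numbers is attained and
    positive.\<close>
  define \<delta> where "\<delta> = Min (range D)"
  have \<delta>: "\<delta> > 0" "\<delta> \<le> D i" for i
    using D(1) by (auto simp: \<delta>_def)
  have "\<bar>sum_functional h \<eta> - sum_functional h \<xi>\<bar> < \<epsilon>"
    if \<eta>: "\<eta> \<in> vec_space M \<rho>" "vec_norm \<rho> (\<lambda>x. \<eta> x - \<xi> x) < ennreal \<delta>" for \<eta>
  proof -
    have close: "\<bar>h i (\<lambda>x. \<eta> x $ i) - h i (\<lambda>x. \<xi> x $ i)\<bar> < e" for i
    proof (rule D(2)[OF vec_space_component[OF \<eta>(1)]])
      have "fs_norm \<rho> (\<lambda>x. \<eta> x $ i - \<xi> x $ i) \<le> vec_norm \<rho> (\<lambda>x. \<eta> x - \<xi> x)"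
        using vec_norm_component_le[of "\<lambda>x. \<eta> x - \<xi> x" i] by simp
      also have "\<dots> < ennreal \<delta>"
        by (rule \<eta>(2))
      also have "\<dots> \<le> ennreal (D i)"
        using \<delta>(2) by (rule ennreal_leI)
      finally show "fs_norm \<rho> (\<lambda>x. \<eta> x $ i - \<xi> x $ i) < ennreal (D i)" .
    qed
    have "\<bar>sum_functional h \<eta> - sum_functional h \<xi>\<bar> \<le>
        (\<Sum>i\<in>UNIV. \<bar>h i (\<lambda>x. \<eta> x $ i) - h i (\<lambda>x. \<xi> x $ i)\<bar>)"
      unfolding sum_functional_def sum_subtractf[symmetric] by (rule sum_abs)
    also have "\<dots> < (\<Sum>i\<in>(UNIV :: 'n set). e)"
      using close by (intro sum_strict_mono) auto
    also have "\<dots> = \<epsilon>"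
      by (simp add: e_def)
    finally show ?thesis .
  qed
  then show "\<exists>\<delta>>0. \<forall>\<eta>\<in>vec_space M \<rho>. vec_norm \<rho> (\<lambda>x. \<eta> x - \<xi> x) < ennreal \<delta> \<longrightarrow>
      \<bar>sum_functional h \<eta> - sum_functional h \<xi>\<bar> < \<epsilon>"
    using \<delta>(1) by blast
qed

lemma sum_functional_dual_space_iff:
  fixes h :: "'n::finite \<Rightarrow> ('a \<Rightarrow> real) \<Rightarrow> real"
  assumes "\<And>i. linear_functional_on M (fspace M \<rho>) (h i)"
  shows "sum_functional h \<in> dual_space M (vec_space M \<rho>) (vec_norm \<rho>) \<longleftrightarrow>
    (\<forall>i. h i \<in> dual_space M (fspace M \<rho>) (fs_norm \<rho>))"
  using assms linear_sum_functional[of h] continuous_sum_functional[of h]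
    continuous_sum_functional_imp_component[of h]
  by (auto simp: dual_space_def)

text \<open>The embedding maps the unit ball of \<open>X\<close> into that of the vector space, and
  the sum functional takes there the values of \<open>h i\<close>.\<close>

lemma dual_norm_le_sum_functional:
  fixes h :: "'n::finite \<Rightarrow> ('a \<Rightarrow> real) \<Rightarrow> real"
  assumes h: "\<And>i. linear_functional_on M (fspace M \<rho>) (h i)"
  shows "dual_norm (fspace M \<rho>) (fs_norm \<rho>) (h i) \<le>
    dual_norm (vec_space M \<rho>) (vec_norm \<rho>) (sum_functional h)"
  unfolding dual_norm_def
proof (rule SUP_mono)
  fix f assume f: "f \<in> {f \<in> fspace M \<rho>. fs_norm \<rho> f \<le> 1}"
  then have "vec_norm \<rho> (\<lambda>x. axis i (f x) :: real ^ 'n) \<le> 1"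
    using vec_norm_axis_le[of f i] fspace_measurable[of f] by (auto intro: order_trans)
  then show "\<exists>\<xi>\<in>{\<xi> \<in> vec_space M \<rho>. vec_norm \<rho> \<xi> \<le> 1}.
      ennreal \<bar>h i f\<bar> \<le> ennreal \<bar>sum_functional h \<xi>\<bar>"
    using f vec_space_axis[of f i]
    by (intro bexI[of _ "\<lambda>x. axis i (f x)"]) (auto simp: sum_functional_axis[OF h])
qed

text \<open>Each coordinate of a vector in the unit ball lies in the unit ball of \<open>X\<close>;
  the triangle inequality for the finite sum does the rest.\<close>

lemma dual_norm_sum_functional_le:
  fixes h :: "'n::finite \<Rightarrow> ('a \<Rightarrow> real) \<Rightarrow> real"
  shows "dual_norm (vec_space M \<rho>) (vec_norm \<rho>) (sum_functional h) \<le>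
    (\<Sum>i\<in>UNIV. dual_norm (fspace M \<rho>) (fs_norm \<rho>) (h i))"
  unfolding dual_norm_def[of "vec_space M \<rho>"]
proof (rule SUP_least)
  fix \<xi> :: "'a \<Rightarrow> real ^ 'n" assume \<xi>: "\<xi> \<in> {\<xi> \<in> vec_space M \<rho>. vec_norm \<rho> \<xi> \<le> 1}"
  have comp: "(\<lambda>x. \<xi> x $ i) \<in> {f \<in> fspace M \<rho>. fs_norm \<rho> f \<le> 1}" for i
    using \<xi> vec_norm_component_le[of \<xi> i] vec_space_component[of \<xi> i]
    by (auto intro: order_trans)
  have "ennreal \<bar>sum_functional h \<xi>\<bar> \<le> ennreal (\<Sum>i\<in>UNIV. \<bar>h i (\<lambda>x. \<xi> x $ i)\<bar>)"
    unfolding sum_functional_def by (intro ennreal_leI sum_abs)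
  also have "\<dots> = (\<Sum>i\<in>UNIV. ennreal \<bar>h i (\<lambda>x. \<xi> x $ i)\<bar>)"
    by simp
  also have "\<dots> \<le> (\<Sum>i\<in>UNIV. dual_norm (fspace M \<rho>) (fs_norm \<rho>) (h i))"
    unfolding dual_norm_def using comp by (intro sum_mono SUP_upper)
  finally show "ennreal \<bar>sum_functional h \<xi>\<bar> \<le>
    (\<Sum>i\<in>UNIV. dual_norm (fspace M \<rho>) (fs_norm \<rho>) (h i))" .
qed

section \<open>Part A: functionals in integral form\<close>

lemma integrals_well_defined_iff:
  fixes g :: "'n::finite \<Rightarrow> 'a \<Rightarrow> real"
  shows "integrals_well_defined M \<rho> g \<longleftrightarrow>
    (\<forall>i. \<forall>f\<in>fspace M \<rho>. integrable M (\<lambda>x. f x * g i x))"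
  unfolding integrals_well_defined_def
proof (intro iffI allI ballI)
  fix i f
  assume int: "\<forall>\<xi>\<in>vec_space M \<rho>. \<forall>i. integrable M (\<lambda>x. (\<xi> x $ i) * g i x)"
    and f: "f \<in> fspace M \<rho>"
  \<comment> \<open>Every element of \<open>X\<close> occurs as the \<open>i\<close>-th component of
    some vector, namely of its own embedding.\<close>
  have "integrable M (\<lambda>x. ((axis i (f x) :: real ^ 'n) $ i) * g i x)"
    by (rule int[rule_format, OF vec_space_axis[OF f]])
  then show "integrable M (\<lambda>x. f x * g i x)"
    by simp
next
  fix i and \<xi> :: "'a \<Rightarrow> real ^ 'n"
  assume int: "\<forall>i. \<forall>f\<in>fspace M \<rho>. integrable M (\<lambda>x. f x * g i x)"
    and \<xi>: "\<xi> \<in> vec_space M \<rho>"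
  show "integrable M (\<lambda>x. (\<xi> x $ i) * g i x)"
    by (rule int[rule_format, OF vec_space_component[OF \<xi>]])
qed

lemma integral_functional_eq_sum_functional:
  "integral_functional M g = sum_functional (\<lambda>i f. \<integral>x. f x * g i x \<partial>M)"
  by (auto simp: integral_functional_def sum_functional_def)

lemma integral_functional_vec_assoc_space_iff:
  fixes g :: "'n::finite \<Rightarrow> 'a \<Rightarrow> real"
  assumes g: "\<And>i. g i \<in> borel_measurable M"
  shows "integrals_well_defined M \<rho> g \<and> integral_functional M g \<in> vec_assoc_space M \<rho> \<longleftrightarrow>
    (\<forall>i. g i \<in> fspace M (assoc_norm M \<rho>))"
proof -
  \<comment> \<open>Once the integrals exist, \<open>g\<close> itself is the witness required by
    \<open>vec_assoc_space\<close>, so only membership in the dual space is left.\<close>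
  have "integral_functional M g \<in> vec_assoc_space M \<rho> \<longleftrightarrow>
      integral_functional M g \<in> dual_space M (vec_space M \<rho>) (vec_norm \<rho>)"
    if "integrals_well_defined M \<rho> g"
    using that g by (auto simp: vec_assoc_space_def)
  moreover have "integral_functional M g \<in> dual_space M (vec_space M \<rho>) (vec_norm \<rho>) \<longleftrightarrow>
      (\<forall>i. (\<lambda>f. \<integral>x. f x * g i x \<partial>M) \<in> dual_space M (fspace M \<rho>) (fs_norm \<rho>))"
    if "integrals_well_defined M \<rho> g"
    unfolding integral_functional_eq_sum_functional
    using that g
    by (intro sum_functional_dual_space_iff linear_functional_integral)
      (auto simp: integrals_well_defined_iff)
  ultimately show ?thesis
    using g by (auto simp: fspace_assoc_iff integrals_well_defined_iff)
qed

end

theorem proposition3p1: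
  fixes M :: "'a measure" and \<rho> :: "('a \<Rightarrow> ennreal) \<Rightarrow> ennreal"
  assumes "ri_banach_function_norm M \<rho>"
    and "CARD('n::finite) \<ge> 2"
  shows
    "(\<forall>g :: 'n \<Rightarrow> 'a \<Rightarrow> real. (\<forall>i. g i \<in> borel_measurable M) \<longrightarrow>
        ((integrals_well_defined M \<rho> g \<and> integral_functional M g \<in> vec_assoc_space M \<rho>)
          \<longleftrightarrow> (\<forall>i. g i \<in> fspace M (assoc_norm M \<rho>))) \<and>
        ((\<forall>i. g i \<in> fspace M (assoc_norm M \<rho>)) \<longrightarrow>
          (MAX i. fs_norm (assoc_norm M \<rho>) (g i))
            \<le> dual_norm (vec_space M \<rho>) (vec_norm \<rho>) (integral_functional M g) \<and>
          dual_norm (vec_space M \<rho>) (vec_norm \<rho>) (integral_functional M g)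
            \<le> (\<Sum>i\<in>UNIV. fs_norm (assoc_norm M \<rho>) (g i))))
     \<and>
     (\<forall>h :: 'n \<Rightarrow> ('a \<Rightarrow> real) \<Rightarrow> real. (\<forall>i. linear_functional_on M (fspace M \<rho>) (h i)) \<longrightarrow>
        (sum_functional h \<in> dual_space M (vec_space M \<rho>) (vec_norm \<rho>)
          \<longleftrightarrow> (\<forall>i. h i \<in> dual_space M (fspace M \<rho>) (fs_norm \<rho>))) \<and>
        ((\<forall>i. h i \<in> dual_space M (fspace M \<rho>) (fs_norm \<rho>)) \<longrightarrow>
          (MAX i. dual_norm (fspace M \<rho>) (fs_norm \<rho>) (h i))
            \<le> dual_norm (vec_space M \<rho>) (vec_norm \<rho>) (sum_functional h) \<and>
          dual_norm (vec_space M \<rho>) (vec_norm \<rho>) (sum_functional h)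
            \<le> (\<Sum>i\<in>UNIV. dual_norm (fspace M \<rho>) (fs_norm \<rho>) (h i))))"
proof (intro conjI allI impI)
  interpret ri_banach_function_norm M \<rho>
    by (rule assms)
  fix g :: "'n \<Rightarrow> 'a \<Rightarrow> real"
  assume g: "\<forall>i. g i \<in> borel_measurable M"
  show "integrals_well_defined M \<rho> g \<and> integral_functional M g \<in> vec_assoc_space M \<rho> \<longleftrightarrow>
      (\<forall>i. g i \<in> fspace M (assoc_norm M \<rho>))"
    using g by (intro integral_functional_vec_assoc_space_iff) blast
  assume "\<forall>i. g i \<in> fspace M (assoc_norm M \<rho>)"
  then have int: "\<And>i f. f \<in> fspace M \<rho> \<Longrightarrow> integrable M (\<lambda>x. f x * g i x)"
    using g by (simp add: fspace_assoc_iff)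
  \<comment> \<open>Rewriting associate norms as dual norms turns both estimates of part A into
    those of part B for the functionals given by integration against \<open>g i\<close>.\<close>
  then have eq: "fs_norm (assoc_norm M \<rho>) (g i) =
      dual_norm (fspace M \<rho>) (fs_norm \<rho>) (\<lambda>f. \<integral>x. f x * g i x \<partial>M)" for i
    using g by (intro assoc_norm_eq_dual_norm) auto
  have lin: "linear_functional_on M (fspace M \<rho>) (\<lambda>f. \<integral>x. f x * g i x \<partial>M)" for i
    using g int by (intro linear_functional_integral) auto
  show "(MAX i. fs_norm (assoc_norm M \<rho>) (g i))
      \<le> dual_norm (vec_space M \<rho>) (vec_norm \<rho>) (integral_functional M g)"
    unfolding integral_functional_eq_sum_functional eq
    using dual_norm_le_sum_functional[of "\<lambda>i f. \<integral>x. f x * g i x \<partial>M", OF lin] by auto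
  show "dual_norm (vec_space M \<rho>) (vec_norm \<rho>) (integral_functional M g)
      \<le> (\<Sum>i\<in>UNIV. fs_norm (assoc_norm M \<rho>) (g i))"
    unfolding integral_functional_eq_sum_functional eq by (rule dual_norm_sum_functional_le)
next
  interpret ri_banach_function_norm M \<rho>
    by (rule assms)
  fix h :: "'n \<Rightarrow> ('a \<Rightarrow> real) \<Rightarrow> real"
  assume h: "\<forall>i. linear_functional_on M (fspace M \<rho>) (h i)"
  show "sum_functional h \<in> dual_space M (vec_space M \<rho>) (vec_norm \<rho>) \<longleftrightarrow>
      (\<forall>i. h i \<in> dual_space M (fspace M \<rho>) (fs_norm \<rho>))"
    using h by (intro sum_functional_dual_space_iff) blast
  show "(MAX i. dual_norm (fspace M \<rho>) (fs_norm \<rho>) (h i))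
      \<le> dual_norm (vec_space M \<rho>) (vec_norm \<rho>) (sum_functional h)"
    using h dual_norm_le_sum_functional[of h] by auto
  show "dual_norm (vec_space M \<rho>) (vec_norm \<rho>) (sum_functional h)
      \<le> (\<Sum>i\<in>UNIV. dual_norm (fspace M \<rho>) (fs_norm \<rho>) (h i))"
    by (rule dual_norm_sum_functional_le)
qed

end
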